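(* Let $\mathcal{A},\mathcal{B}\in\mathbb{C}^{\mathbf{N}(n)\times\mathbf{N}(n)}$ be core tensors. Then the following are equivalent: (a) $(\mathcal{A}*_n\mathcal{B})^{\#}=\mathcal{B}^{\mathrm{core}}*_n\mathcal{A}^{\mathrm{core}}$ and $(\mathcal{B}*_n\mathcal{A})^{\#}=\mathcal{A}^{\mathrm{core}}*_n\mathcal{B}^{\mathrm{core}}$; (b) $\mathcal{A}^{\mathrm{core}}*_n\mathcal{A}*_n\mathcal{B}=\mathcal{B}*_n\mathcal{A}*_n\mathcal{A}^{\mathrm{core}}$, $\mathcal{B}^{\mathrm{core}}*_n\mathcal{B}*_n\mathcal{A}=\mathcal{A}*_n\mathcal{B}*_n\mathcal{B}^{\mathrm{core}}$, and $\mathcal{A}*_n\mathcal{A}^{\mathrm{core}}*_n\mathcal{B}^{\mathrm{core}}=\mathcal{B}^{\mathrm{core}}*_n\mathcal{A}^{\mathrm{core}}*_n\mathcal{A}$.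
   Context: Here $\mathbf{N}(n)=N_1\times\cdots\times N_n$ and $\mathbb{C}^{\mathbf{N}(n)\times\mathbf{N}(n)}$ is the set of complex tensors $\mathcal{A}=(a_{i_1\ldots i_n j_1\ldots j_n})$ with $1\le i_k,j_k\le N_k$. The Einstein product is $(\mathcal{A}*_n\mathcal{B})_{i_1\ldots i_n j_1\ldots j_n}=\sum_{k_1,\ldots,k_n}a_{i_1\ldots i_n k_1\ldots k_n}b_{k_1\ldots k_n j_1\ldots j_n}$ (and similarly $\mathcal{A}*_n\mathcal{X}\in\mathbb{C}^{\mathbf{N}(n)}$ for $\mathcal{X}\in\mathbb{C}^{\mathbf{N}(n)}$), powers are taken with respect to $*_n$, and $\mathcal{A}^*$ is the conjugate transpose (swap the first $n$ and last $n$ indices and conjugate). The range is $\mathscr{R}(\mathcal{A})=\{\mathcal{A}*_n\mathcal{X}:\mathcal{X}\in\mathbb{C}^{\mathbf{N}(n)}\}$. The index $\mathrm{ind}(\mathcal{A})$ is the smallest positive integer $k$ with $\mathscr{R}(\mathcal{A}^k)=\mathscr{R}(\mathcal{A}^{k+1})$; $\mathcal{A}$ is a core tensor if $\mathrm{ind}(\mathcal{A})=1$. The core inverse $\mathcal{A}^{\mathrm{core}}$ is the (unique, existing when $\mathcal{A}$ is a core tensor) tensor $\mathcal{X}$ with $(\mathcal{A}*_n\mathcal{X})^*=\mathcal{A}*_n\mathcal{X}$, $\mathcal{X}*_n\mathcal{A}^2=\mathcal{A}$, $\mathcal{A}*_n\mathcal{X}^2=\mathcal{X}$. The group inverse $\mathcal{A}^{\#}$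 is the tensor $\mathcal{X}$ (unique when it exists; it exists when $\mathrm{ind}(\mathcal{A})=1$) with $\mathcal{A}^2*_n\mathcal{X}=\mathcal{A}$, $\mathcal{X}*_n\mathcal{A}*_n\mathcal{X}=\mathcal{X}$, $\mathcal{X}*_n\mathcal{A}=\mathcal{A}*_n\mathcal{X}$. An equality involving a group inverse is understood to include its existence. *)

theory Defs
  imports Complex_Main
begin

text \<open>
  The dimensions N_1, ..., N_n are the entries of a list N, so n is the length of N, and a
  multi-index (i_1, ..., i_n) is a list. Each i_k runs over
  1, ..., N_k.
\<close>

definition multi_indices :: "nat list \<Rightarrow> nat list set" where
  "multi_indices N = {i. length i = length N \<and> (\<forall>k<length N. 1 \<le> i ! k \<and> i ! k \<le> N ! k)}"

text \<open>
  Tensors are represented by functions that vanish outside the index range, so that equality in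
  the carrier sets below is entrywise equality over the index range.
\<close>

type_synonym vec_tensor = "nat list \<Rightarrow> complex"
type_synonym sq_tensor = "nat list \<Rightarrow> nat list \<Rightarrow> complex"

definition vec_tensors :: "nat list \<Rightarrow> vec_tensor set" where
  "vec_tensors N = {X. \<forall>i. i \<notin> multi_indices N \<longrightarrow> X i = 0}"

definition sq_tensors :: "nat list \<Rightarrow> sq_tensor set" where
  "sq_tensors N =
     {A. \<forall>i j. i \<notin> multi_indices N \<or> j \<notin> multi_indices N \<longrightarrow> A i j = 0}"

definition eprod :: "nat list \<Rightarrow> sq_tensor \<Rightarrow> sq_tensor \<Rightarrow> sq_tensor" where
  "eprod N A B = (\<lambda>i j. \<Sum>k\<in>multi_indices N. A i k * B k j)"

abbreviation eprod_syntax :: "sq_tensor \<Rightarrow> nat list \<Rightarrow> sq_tensor \<Rightarrow> sq_tensor"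
    (\<open>(_ \<star>\<^bsub>_\<^esub> _)\<close> [70, 0, 71] 70) where
  "A \<star>\<^bsub>N\<^esub> B \<equiv> eprod N A B"

definition eprod_vec :: "nat list \<Rightarrow> sq_tensor \<Rightarrow> vec_tensor \<Rightarrow> vec_tensor" where
  "eprod_vec N A X = (\<lambda>i. \<Sum>k\<in>multi_indices N. A i k * X k)"

definition unit_tensor :: "nat list \<Rightarrow> sq_tensor" where
  "unit_tensor N = (\<lambda>i j. if i \<in> multi_indices N \<and> i = j then 1 else 0)"

primrec tensor_pow :: "nat list \<Rightarrow> sq_tensor \<Rightarrow> nat \<Rightarrow> sq_tensor" where
  "tensor_pow N A 0 = unit_tensor N"
| "tensor_pow N A (Suc k) = tensor_pow N A k \<star>\<^bsub>N\<^esub> A"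

definition conj_transpose :: "sq_tensor \<Rightarrow> sq_tensor" where
  "conj_transpose A = (\<lambda>i j. cnj (A j i))"

definition tensor_range :: "nat list \<Rightarrow> sq_tensor \<Rightarrow> vec_tensor set" where
  "tensor_range N A = {eprod_vec N A X | X. X \<in> vec_tensors N}"

definition tensor_index :: "nat list \<Rightarrow> sq_tensor \<Rightarrow> nat" where
  "tensor_index N A =
     (LEAST k. 0 < k \<and> tensor_range N (tensor_pow N A k) = tensor_range N (tensor_pow N A (k + 1)))"

definition core_tensor :: "nat list \<Rightarrow> sq_tensor \<Rightarrow> bool" where
  "core_tensor N A \<longleftrightarrow> A \<in> sq_tensors N \<and> tensor_index N A = 1"

definition is_core_inverse :: "nat list \<Rightarrow> sq_tensor \<Rightarrow> sq_tensor \<Rightarrow> bool" where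
  "is_core_inverse N A X \<longleftrightarrow>
     X \<in> sq_tensors N \<and>
     conj_transpose (A \<star>\<^bsub>N\<^esub> X) = A \<star>\<^bsub>N\<^esub> X \<and>
     X \<star>\<^bsub>N\<^esub> tensor_pow N A 2 = A \<and>
     A \<star>\<^bsub>N\<^esub> tensor_pow N X 2 = X"

definition core_inverse :: "nat list \<Rightarrow> sq_tensor \<Rightarrow> sq_tensor" where
  "core_inverse N A = (THE X. is_core_inverse N A X)"

definition is_group_inverse :: "nat list \<Rightarrow> sq_tensor \<Rightarrow> sq_tensor \<Rightarrow> bool" where
  "is_group_inverse N A X \<longleftrightarrow>
     X \<in> sq_tensors N \<and>
     tensor_pow N A 2 \<star>\<^bsub>N\<^esub> X = A \<and>
     X \<star>\<^bsub>N\<^esub> A \<star>\<^bsub>N\<^esub> X = X \<and>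
     X \<star>\<^bsub>N\<^esub> A = A \<star>\<^bsub>N\<^esub> X"

definition group_invertible :: "nat list \<Rightarrow> sq_tensor \<Rightarrow> bool" where
  "group_invertible N A \<longleftrightarrow> (\<exists>X. is_group_inverse N A X)"

text \<open>Unspecified unless \<^const>\<open>group_invertible\<close> holds.\<close>

definition group_inverse :: "nat list \<Rightarrow> sq_tensor \<Rightarrow> sq_tensor" where
  "group_inverse N A = (THE X. is_group_inverse N A X)"

end

theory Submission imports Defs begin

text \<open>
  Under the Einstein product and the conjugate transpose, tensors form a semigroup with involution
  in which the powers of an element are linearly dependent. Finite dimension is needed only to
  show that core tensors have core inverses (\<open>is_core_inverse_core_inverse\<close>); the equivalence
  itself is then an identity chase in an arbitrary semigroup with involution
  (\<open>group_inv_core_products_iff\<close>).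

  For the chase, let \<open>x\<close> and \<open>y\<close> be the core inverses of \<open>a\<close> and \<open>b\<close>, and let \<open>p = a x\<close> and
  \<open>q = b y\<close>, which are the orthogonal projections onto the ranges of \<open>a\<close> and \<open>b\<close>. That the three
  identities give the two group inverses is a direct computation. Conversely, the two group
  inverses place the ranges of \<open>b a\<close> and \<open>y x\<close> inside the range of \<open>a\<close>, so that
  \<open>p b p = b p\<close> and \<open>p y p = y p\<close>, whence \<open>p q p = q p\<close>. The left-hand side is self-adjoint,
  so \<open>p\<close> and \<open>q\<close> commute. The identities follow from this and from the absorption laws
  \<open>a b p = a b\<close> and \<open>b a q = b a\<close>.

  For existence, a nontrivial linear relation between the powers of \<open>A\<close> yields
  \<open>A ^ m = A ^ (m + 1) q\<close> for some \<open>m \<ge> 1\<close> and some \<open>q\<close> that commutes with \<open>A\<close>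
  (\<open>tensor_pow_strongly_regular\<close>). It is used three times: the ranges of the powers of \<open>A\<close>
  become stationary, so the index really is attained; if \<open>A\<close> has index 1, then \<open>A = A A g\<close> for a
  \<open>g\<close> commuting with \<open>A\<close>; and, for the Hermitian tensor \<open>A\<^sup>* A\<close> in place of \<open>A\<close>, it gives
  a \<open>w\<close> with \<open>A w A = A\<close> and \<open>A w\<close> Hermitian. The core inverse is then \<open>g A w\<close>.
\<close>

section \<open>Core and group inverses in a semigroup with involution\<close>

text \<open>
  No unit is assumed. The Einstein product is associative on all functions of two multi-indices,
  whereas the unit tensor is neutral only for those vanishing outside the index range.
\<close>

locale star_semigroup = semigroup f for f :: "'a \<Rightarrow> 'a \<Rightarrow> 'a" (infixl \<open>\<cdot>\<close> 70) +
  fixes star :: "'a \<Rightarrow> 'a"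
  assumes star_mult: "star (a \<cdot> b) = star b \<cdot> star a"
    and star_star: "star (star a) = a"
begin

text \<open>\<open>x\<close> is a core inverse of \<open>a\<close>; it follows that \<open>a \<cdot> x\<close> is a self-adjoint idempotent.\<close>

definition core_inv :: "'a \<Rightarrow> 'a \<Rightarrow> bool" where
  "core_inv a x \<longleftrightarrow> star (a \<cdot> x) = a \<cdot> x \<and> x \<cdot> (a \<cdot> a) = a \<and> a \<cdot> (x \<cdot> x) = x"

text \<open>\<open>x\<close> is a group inverse of \<open>a\<close>; the defining equations are the ones used for tensors.\<close>

definition group_inv :: "'a \<Rightarrow> 'a \<Rightarrow> bool" where
  "group_inv a x \<longleftrightarrow> a \<cdot> a \<cdot> x = a \<and> x \<cdot> a \<cdot> x = x \<and> x \<cdot> a = a \<cdot> x"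

lemma core_inv_inner:
  assumes "core_inv a x"
  shows "a \<cdot> x \<cdot> a = a" and "x \<cdot> a \<cdot> x = x"
  using assms unfolding core_inv_def by (metis assoc)+

lemma core_inv_unique:
  assumes x: "core_inv a x" and y: "core_inv a y"
  shows "x = y"
proof -
  have "(a \<cdot> x) \<cdot> (a \<cdot> y) = a \<cdot> y" "(a \<cdot> y) \<cdot> (a \<cdot> x) = a \<cdot> x"
    using core_inv_inner(1)[OF x] core_inv_inner(1)[OF y] by (metis assoc)+
  then have eq: "a \<cdot> x = a \<cdot> y"
    using x y star_mult unfolding core_inv_def by metis
  have "x = x \<cdot> (a \<cdot> y)"
    using core_inv_inner(2)[OF x] eq by (metis assoc)
  also have "\<dots> = x \<cdot> (a \<cdot> a) \<cdot> (y \<cdot> y)"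
    using y unfolding core_inv_def by (metis assoc)
  also have "\<dots> = y"
    using x y unfolding core_inv_def by simp
  finally show ?thesis .
qed

lemma group_inv_unique:
  assumes x: "group_inv a x" and y: "group_inv a y"
  shows "x = y"
proof -
  have "x \<cdot> a = x \<cdot> (a \<cdot> a \<cdot> y)"
    using y unfolding group_inv_def by simp
  also have "\<dots> = (a \<cdot> a \<cdot> x) \<cdot> y"
    using x unfolding group_inv_def by (metis assoc)
  finally have "x \<cdot> a = a \<cdot> y"
    using x unfolding group_inv_def by simp
  then show ?thesis
    using x y unfolding group_inv_def by (metis assoc)
qed

text \<open>
  Here \<open>g \<cdot> a \<cdot> g\<close> is the group inverse of \<open>a\<close>, \<open>w\<close> is an inner inverse of \<open>a\<close>, and the witness equals
  \<open>(g \<cdot> a \<cdot> g) \<cdot> a \<cdot> w\<close>.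
\<close>

lemma core_inv_exists:
  assumes "a \<cdot> a \<cdot> g = a" and comm: "g \<cdot> a = a \<cdot> g"
    and w: "a \<cdot> w \<cdot> a = a" "star (a \<cdot> w) = a \<cdot> w"
  shows "core_inv a (g \<cdot> a \<cdot> w)"
proof -
  have g: "a \<cdot> g \<cdot> a = a" "g \<cdot> (a \<cdot> a) = a"
    using assms by (metis assoc)+
  have "a \<cdot> (g \<cdot> a \<cdot> w) = a \<cdot> w"
    using g by (metis assoc)
  moreover have "g \<cdot> a \<cdot> w \<cdot> (a \<cdot> a) = a"
    using g w by (metis assoc)
  moreover have "a \<cdot> w \<cdot> (g \<cdot> a \<cdot> w) = g \<cdot> a \<cdot> w"
    using comm w by (metis assoc)
  ultimately show ?thesis
    using w unfolding core_inv_def by (metis assoc)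
qed

lemma group_inv_core_products_if:
  assumes x: "core_inv a x" and y: "core_inv b y"
    and 1: "x \<cdot> a \<cdot> b = b \<cdot> a \<cdot> x" and 2: "y \<cdot> b \<cdot> a = a \<cdot> b \<cdot> y"
    and 3: "a \<cdot> x \<cdot> y = y \<cdot> x \<cdot> a"
  shows "group_inv (a \<cdot> b) (y \<cdot> x)" and "group_inv (b \<cdot> a) (x \<cdot> y)"
proof -
  note a = core_inv_inner[OF x] and b = core_inv_inner[OF y]
  have ab: "a \<cdot> b \<cdot> (y \<cdot> x) = y \<cdot> b \<cdot> a \<cdot> x"
    using 2 by (metis assoc)
  have "y \<cdot> x \<cdot> (a \<cdot> b) = a \<cdot> b \<cdot> (y \<cdot> x)"
    using 1 2 by (metis assoc)
  moreover have "a \<cdot> b \<cdot> (a \<cdot> b) \<cdot> (y \<cdot> x) = a \<cdot> b"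
  proof -
    have "a \<cdot> b \<cdot> (a \<cdot> b) \<cdot> (y \<cdot> x) = a \<cdot> (b \<cdot> y \<cdot> b) \<cdot> a \<cdot> x"
      using ab by (metis assoc)
    also have "\<dots> = a \<cdot> (x \<cdot> a \<cdot> b)"
      using b 1 by (metis assoc)
    finally show ?thesis using a by (metis assoc)
  qed
  moreover have "y \<cdot> x \<cdot> (a \<cdot> b) \<cdot> (y \<cdot> x) = y \<cdot> x"
  proof -
    have "y \<cdot> x \<cdot> (a \<cdot> b) \<cdot> (y \<cdot> x) = y \<cdot> b \<cdot> (a \<cdot> x \<cdot> y) \<cdot> x"
      using 1 by (metis assoc)
    also have "\<dots> = (y \<cdot> b \<cdot> y) \<cdot> (x \<cdot> a \<cdot> x)"
      using 3 by (metis assoc)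
    finally show ?thesis using a b by simp
  qed
  ultimately show "group_inv (a \<cdot> b) (y \<cdot> x)"
    unfolding group_inv_def by blast
  have "x \<cdot> y \<cdot> (b \<cdot> a) = b \<cdot> a \<cdot> (x \<cdot> y)"
    using 1 2 by (metis assoc)
  moreover have "b \<cdot> a \<cdot> (b \<cdot> a) \<cdot> (x \<cdot> y) = b \<cdot> a"
  proof -
    have "b \<cdot> a \<cdot> (b \<cdot> a) \<cdot> (x \<cdot> y) = b \<cdot> a \<cdot> (x \<cdot> a \<cdot> b) \<cdot> y"
      using 1 by (metis assoc)
    also have "\<dots> = b \<cdot> (a \<cdot> b \<cdot> y)"
      using a by (metis assoc)
    also have "\<dots> = b \<cdot> a"
      using 2 b by (metis assoc)
    finally show ?thesis .
  qed
  moreover have "x \<cdot> y \<cdot> (b \<cdot> a) \<cdot> (x \<cdot> y) = x \<cdot> y"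
  proof -
    have "x \<cdot> y \<cdot> (b \<cdot> a) \<cdot> (x \<cdot> y) = x \<cdot> (y \<cdot> b) \<cdot> (a \<cdot> x \<cdot> y)"
      by (simp add: assoc)
    also have "\<dots> = x \<cdot> (y \<cdot> b \<cdot> y) \<cdot> (x \<cdot> a)"
      unfolding 3 by (simp add: assoc)
    also have "\<dots> = x \<cdot> (a \<cdot> x \<cdot> y)"
      using b 3 by (metis assoc)
    finally show ?thesis using a by (metis assoc)
  qed
  ultimately show "group_inv (b \<cdot> a) (x \<cdot> y)"
    unfolding group_inv_def by blast
qed

text \<open>
  The assumptions are symmetric in \<open>(a, x)\<close> and \<open>(b, y)\<close>, so both identities also hold with the
  two pairs interchanged.
\<close>

lemma core_identities_if_group_inv:
  assumes x: "core_inv a x" and y: "core_inv b y"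
    and ab: "group_inv (a \<cdot> b) (y \<cdot> x)" and ba: "group_inv (b \<cdot> a) (x \<cdot> y)"
  shows "x \<cdot> a \<cdot> b = b \<cdot> a \<cdot> x" and "a \<cdot> x \<cdot> y = y \<cdot> x \<cdot> a"
proof -
  note a = core_inv_inner[OF x] and b = core_inv_inner[OF y]
  have a': "x \<cdot> (a \<cdot> a) = a" "a \<cdot> (x \<cdot> x) = x" "star (a \<cdot> x) = a \<cdot> x"
    and b': "y \<cdot> (b \<cdot> b) = b" "b \<cdot> (y \<cdot> y) = y" "star (b \<cdot> y) = b \<cdot> y"
    using x y unfolding core_inv_def by auto
  \<comment> \<open>The ranges of \<open>b \<cdot> a\<close> and \<open>y \<cdot> x\<close> lie in the range of \<open>a\<close>.\<close>
  have "b \<cdot> a = x \<cdot> y \<cdot> (b \<cdot> a) \<cdot> (b \<cdot> a)"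
    using ba unfolding group_inv_def by (metis assoc)
  then have F1: "a \<cdot> x \<cdot> (b \<cdot> a) = b \<cdot> a"
    using a' by (metis assoc)
  have "y \<cdot> x = a \<cdot> b \<cdot> (y \<cdot> x) \<cdot> (y \<cdot> x)"
    using ab unfolding group_inv_def by (metis assoc)
  then have F2: "a \<cdot> x \<cdot> (y \<cdot> x) = y \<cdot> x"
    using a by (metis assoc)
  \<comment> \<open>\<open>a \<cdot> b = a \<cdot> b \<cdot> a \<cdot> b \<cdot> y \<cdot> x\<close> and \<open>x \<cdot> a \<cdot> x = x\<close>.\<close>
  have F5: "a \<cdot> b \<cdot> (a \<cdot> x) = a \<cdot> b"
    using ab a unfolding group_inv_def by (metis assoc)
  have F6: "b \<cdot> a \<cdot> (b \<cdot> y) = b \<cdot> a"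
    using ba b unfolding group_inv_def by (metis assoc)
  have "x \<cdot> a \<cdot> b = x \<cdot> (a \<cdot> (b \<cdot> a)) \<cdot> x"
    using F5 by (metis assoc)
  also have "\<dots> = (x \<cdot> (a \<cdot> a)) \<cdot> x \<cdot> (b \<cdot> a) \<cdot> x"
    using F1 by (metis assoc)
  also have "\<dots> = b \<cdot> a \<cdot> x"
    unfolding a' F1 ..
  finally show 1: "x \<cdot> a \<cdot> b = b \<cdot> a \<cdot> x" .
  let ?p = "a \<cdot> x" and ?q = "b \<cdot> y"
  have py: "?p \<cdot> (y \<cdot> ?p) = y \<cdot> ?p"
  proof -
    have "y \<cdot> ?p = y \<cdot> x \<cdot> (a \<cdot> a \<cdot> x)"
      using a' by (metis assoc)
    then show ?thesis using F2 by (metis assoc)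
  qed
  have pb: "?p \<cdot> (b \<cdot> ?p) = b \<cdot> ?p"
    using F1 by (metis assoc)
  have "?p \<cdot> (?q \<cdot> ?p) = (?p \<cdot> (b \<cdot> ?p)) \<cdot> (y \<cdot> ?p)"
    using py by (metis assoc)
  also have "\<dots> = ?q \<cdot> ?p"
    unfolding pb using py by (metis assoc)
  finally have "?p \<cdot> (?q \<cdot> ?p) = ?q \<cdot> ?p" .
  \<comment> \<open>The left-hand side is self-adjoint, hence so is \<open>?q \<cdot> ?p\<close>.\<close>
  then have comm: "?p \<cdot> ?q = ?q \<cdot> ?p"
    using a'(3) b'(3) star_mult by (metis assoc)
  \<comment> \<open>Expanding \<open>y \<cdot> x\<close> exposes a factor \<open>b \<cdot> a\<close>, which absorbs \<open>?q\<close> on the right.\<close>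
  have "y \<cdot> x \<cdot> a = y \<cdot> x \<cdot> (y \<cdot> x) \<cdot> (a \<cdot> b) \<cdot> a"
    using ab unfolding group_inv_def by (metis assoc)
  also have "\<dots> = y \<cdot> x \<cdot> (y \<cdot> x) \<cdot> (a \<cdot> b) \<cdot> a \<cdot> ?q"
    using F6 by (metis assoc)
  also have "\<dots> = y \<cdot> x \<cdot> a \<cdot> ?q"
    using ab unfolding group_inv_def by (metis assoc)
  also have "\<dots> = y \<cdot> b \<cdot> (a \<cdot> x \<cdot> y)"
    using 1 by (metis assoc)
  also have "\<dots> = y \<cdot> b \<cdot> (?p \<cdot> ?q) \<cdot> y"
    using b' by (metis assoc)
  also have "\<dots> = (y \<cdot> (b \<cdot> b)) \<cdot> y \<cdot> ?p \<cdot> y"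
    unfolding comm by (simp add: assoc)
  also have "\<dots> = ?p \<cdot> (b \<cdot> (y \<cdot> y))"
    unfolding b'(1) using comm by (metis assoc)
  finally show "a \<cdot> x \<cdot> y = y \<cdot> x \<cdot> a"
    unfolding b'(2) by simp
qed

theorem group_inv_core_products_iff:
  assumes x: "core_inv a x" and y: "core_inv b y"
  shows "group_inv (a \<cdot> b) (y \<cdot> x) \<and> group_inv (b \<cdot> a) (x \<cdot> y) \<longleftrightarrow>
    x \<cdot> a \<cdot> b = b \<cdot> a \<cdot> x \<and> y \<cdot> b \<cdot> a = a \<cdot> b \<cdot> y \<and> a \<cdot> x \<cdot> y = y \<cdot> x \<cdot> a"
  using group_inv_core_products_if[OF x y] core_identities_if_group_inv[OF x y]
    core_identities_if_group_inv(1)[OF y x] by blast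

end

section \<open>The star semigroup of tensors\<close>

lemma finite_multi_indices: "finite (multi_indices N)"
proof (rule finite_subset)
  show "multi_indices N \<subseteq> {i. set i \<subseteq> {..sum_list N} \<and> length i = length N}"
    unfolding multi_indices_def
    by (auto simp: in_set_conv_nth) (meson elem_le_sum_list le_trans)
  show "finite {i. set i \<subseteq> {..sum_list N} \<and> length i = length N}"
    by (rule finite_lists_length_eq) simp
qed

lemma eprod_assoc: "A \<star>\<^bsub>N\<^esub> B \<star>\<^bsub>N\<^esub> C = A \<star>\<^bsub>N\<^esub> (B \<star>\<^bsub>N\<^esub> C)"
proof (intro ext)
  fix i j
  have "(A \<star>\<^bsub>N\<^esub> B \<star>\<^bsub>N\<^esub> C) i j
      = (\<Sum>k\<in>multi_indices N. \<Sum>l\<in>multi_indices N. A i l * B l k * C k j)"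
    by (simp add: eprod_def sum_distrib_right)
  also have "\<dots> = (\<Sum>l\<in>multi_indices N. \<Sum>k\<in>multi_indices N. A i l * B l k * C k j)"
    by (rule sum.swap)
  also have "\<dots> = (A \<star>\<^bsub>N\<^esub> (B \<star>\<^bsub>N\<^esub> C)) i j"
    by (simp add: eprod_def sum_distrib_left mult.assoc)
  finally show "(A \<star>\<^bsub>N\<^esub> B \<star>\<^bsub>N\<^esub> C) i j = (A \<star>\<^bsub>N\<^esub> (B \<star>\<^bsub>N\<^esub> C)) i j" .
qed

interpretation tensor: star_semigroup "eprod N" conj_transpose for N
  by unfold_locales
    (simp_all add: eprod_assoc conj_transpose_def fun_eq_iff, simp add: eprod_def mult.commute)

lemma eprod_vec_assoc: "eprod_vec N (A \<star>\<^bsub>N\<^esub> B) X = eprod_vec N A (eprod_vec N B X)"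
proof
  fix i
  have "eprod_vec N (A \<star>\<^bsub>N\<^esub> B) X i
      = (\<Sum>k\<in>multi_indices N. \<Sum>l\<in>multi_indices N. A i l * B l k * X k)"
    by (simp add: eprod_def eprod_vec_def sum_distrib_right)
  also have "\<dots> = (\<Sum>l\<in>multi_indices N. \<Sum>k\<in>multi_indices N. A i l * B l k * X k)"
    by (rule sum.swap)
  also have "\<dots> = eprod_vec N A (eprod_vec N B X) i"
    by (simp add: eprod_vec_def sum_distrib_left mult.assoc)
  finally show "eprod_vec N (A \<star>\<^bsub>N\<^esub> B) X i = eprod_vec N A (eprod_vec N B X) i" .
qed

lemma eprod_closed:
  "A \<in> sq_tensors N \<Longrightarrow> B \<in> sq_tensors N \<Longrightarrow> A \<star>\<^bsub>N\<^esub> B \<in> sq_tensors N"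
  by (auto simp: sq_tensors_def eprod_def)

lemma eprod_vec_closed: "A \<in> sq_tensors N \<Longrightarrow> eprod_vec N A X \<in> vec_tensors N"
  by (auto simp: sq_tensors_def vec_tensors_def eprod_vec_def)

lemma conj_transpose_closed: "A \<in> sq_tensors N \<Longrightarrow> conj_transpose A \<in> sq_tensors N"
  by (auto simp: sq_tensors_def conj_transpose_def)

lemma unit_tensor_closed: "unit_tensor N \<in> sq_tensors N"
  by (auto simp: sq_tensors_def unit_tensor_def)

lemma tensor_pow_closed: "A \<in> sq_tensors N \<Longrightarrow> tensor_pow N A k \<in> sq_tensors N"
  by (induction k) (auto simp: unit_tensor_closed eprod_closed)

lemma eprod_unit_left:
  assumes "A \<in> sq_tensors N"
  shows "unit_tensor N \<star>\<^bsub>N\<^esub> A = A"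
proof (intro ext)
  fix i j
  have "(unit_tensor N \<star>\<^bsub>N\<^esub> A) i j = (\<Sum>k\<in>multi_indices N. if k = i then A i j else 0)"
    unfolding eprod_def unit_tensor_def by (rule sum.cong) auto
  also have "\<dots> = A i j"
    using assms by (auto simp: finite_multi_indices sq_tensors_def)
  finally show "(unit_tensor N \<star>\<^bsub>N\<^esub> A) i j = A i j" .
qed

lemma eprod_unit_right:
  assumes "A \<in> sq_tensors N"
  shows "A \<star>\<^bsub>N\<^esub> unit_tensor N = A"
proof (intro ext)
  fix i j
  have "(A \<star>\<^bsub>N\<^esub> unit_tensor N) i j = (\<Sum>k\<in>multi_indices N. if k = j then A i j else 0)"
    unfolding eprod_def unit_tensor_def by (rule sum.cong) auto
  also have "\<dots> = A i j"
    using assms by (auto simp: finite_multi_indices sq_tensors_def)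
  finally show "(A \<star>\<^bsub>N\<^esub> unit_tensor N) i j = A i j" .
qed

lemma tensor_pow_1: "A \<in> sq_tensors N \<Longrightarrow> tensor_pow N A (Suc 0) = A"
  by (simp add: eprod_unit_left)

lemma tensor_pow_2: "A \<in> sq_tensors N \<Longrightarrow> tensor_pow N A 2 = A \<star>\<^bsub>N\<^esub> A"
  by (simp add: numeral_2_eq_2 eprod_unit_left)

lemma tensor_pow_add:
  assumes "A \<in> sq_tensors N"
  shows "tensor_pow N A (k + l) = tensor_pow N A k \<star>\<^bsub>N\<^esub> tensor_pow N A l"
  by (induction l) (simp_all add: assms eprod_unit_right tensor_pow_closed eprod_assoc)

lemma eprod_sum_right:
  "A \<star>\<^bsub>N\<^esub> (\<lambda>i j. \<Sum>s\<in>S. c s * B s i j) = (\<lambda>i j. \<Sum>s\<in>S. c s * (A \<star>\<^bsub>N\<^esub> B s) i j)"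
proof (intro ext)
  fix i j
  show "(A \<star>\<^bsub>N\<^esub> (\<lambda>i j. \<Sum>s\<in>S. c s * B s i j)) i j = (\<Sum>s\<in>S. c s * (A \<star>\<^bsub>N\<^esub> B s) i j)"
    unfolding eprod_def sum_distrib_left
    by (subst sum.swap) (simp add: mult.left_commute)
qed

lemma eprod_sum_left:
  "(\<lambda>i j. \<Sum>s\<in>S. c s * B s i j) \<star>\<^bsub>N\<^esub> A = (\<lambda>i j. \<Sum>s\<in>S. c s * (B s \<star>\<^bsub>N\<^esub> A) i j)"
proof (intro ext)
  fix i j
  show "((\<lambda>i j. \<Sum>s\<in>S. c s * B s i j) \<star>\<^bsub>N\<^esub> A) i j = (\<Sum>s\<in>S. c s * (B s \<star>\<^bsub>N\<^esub> A) i j)"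
    unfolding eprod_def sum_distrib_left sum_distrib_right
    by (subst sum.swap) (simp add: mult.assoc)
qed

section \<open>Linear dependence of the powers\<close>

text \<open>
  More vectors than coordinates are linearly dependent. The vectors form an indexed family rather
  than a set, so repetitions among them need no separate treatment.
\<close>

lemma nontrivial_relation:
  fixes v :: "'b \<Rightarrow> 'c \<Rightarrow> 'k::field"
  assumes "finite I" "finite J" "card I < card J"
  shows "\<exists>c. (\<exists>j\<in>J. c j \<noteq> 0) \<and> (\<forall>i\<in>I. (\<Sum>j\<in>J. c j * v j i) = 0)"
  using assms
proof (induction I arbitrary: J v rule: finite_induct)
  case empty
  then obtain j where "j \<in> J" by fastforce
  then show ?case by (intro exI[of _ "\<lambda>_. 1"]) auto
next
  case (insert i0 I)
  show ?case
  proof (cases "\<forall>j\<in>J. v j i0 = 0")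
    case True
    then show ?thesis using insert.IH[of J v] insert.prems insert.hyps by auto
  next
    case False
    then obtain j0 where j0: "j0 \<in> J" "v j0 i0 \<noteq> 0" by blast
    \<comment> \<open>Gaussian elimination: the vector \<open>v j0\<close> clears the coordinate \<open>i0\<close> of all the others.\<close>
    let ?J = "J - {j0}" and ?v = "\<lambda>j i. v j i - v j i0 / v j0 i0 * v j0 i"
    have "card I < card ?J" using insert.prems insert.hyps j0 by simp
    then obtain c where c: "\<exists>j\<in>?J. c j \<noteq> 0" "\<forall>i\<in>I. (\<Sum>j\<in>?J. c j * ?v j i) = 0"
      using insert.IH[of ?J ?v] insert.prems by auto
    let ?s = "\<Sum>j\<in>?J. c j * (v j i0 / v j0 i0)"
    let ?c = "\<lambda>j. if j = j0 then - ?s else c j"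
    have sum: "(\<Sum>j\<in>J. ?c j * v j i) = (\<Sum>j\<in>?J. c j * ?v j i)" for i
    proof -
      have "(\<Sum>j\<in>J. ?c j * v j i) = - ?s * v j0 i + (\<Sum>j\<in>?J. c j * v j i)"
        using j0 insert.prems by (subst sum.remove[of _ j0]) auto
      also have "\<dots> = (\<Sum>j\<in>?J. c j * ?v j i)"
        by (simp add: right_diff_distrib sum_subtractf sum_distrib_right mult.assoc)
      finally show ?thesis .
    qed
    have "(\<Sum>j\<in>?J. c j * ?v j i0) = 0" using j0 by simp
    with c(2) have "\<forall>i\<in>insert i0 I. (\<Sum>j\<in>J. ?c j * v j i) = 0"
      unfolding sum by auto
    moreover have "\<exists>j\<in>J. ?c j \<noteq> 0" using c(1) by auto
    ultimately show ?thesis by (intro exI[of _ ?c]) blast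
  qed
qed

text \<open>
  In a nontrivial relation between the positive powers of \<open>A\<close>, the lowest power that occurs is
  expressed through the higher ones; \<open>q\<close> is a polynomial in \<open>A\<close>.
\<close>

lemma tensor_pow_strongly_regular:
  assumes A: "A \<in> sq_tensors N"
  obtains m q where "q \<in> sq_tensors N" "q \<star>\<^bsub>N\<^esub> A = A \<star>\<^bsub>N\<^esub> q"
    "tensor_pow N A (Suc m) = tensor_pow N A (Suc (Suc m)) \<star>\<^bsub>N\<^esub> q"
proof -
  let ?I = "multi_indices N \<times> multi_indices N"
  let ?d = "card ?I"
  obtain c where c: "\<exists>j\<in>{..?d}. c j \<noteq> 0"
    and rel: "\<forall>(i, k)\<in>?I. (\<Sum>j\<le>?d. c j * tensor_pow N A (Suc j) i k) = 0"
    using nontrivial_relation[of ?I "{..?d}" "\<lambda>j (i, k). tensor_pow N A (Suc j) i k"]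
    by (auto simp: finite_multi_indices)
  define m where "m = (LEAST j. c j \<noteq> 0)"
  have m: "c m \<noteq> 0" and below: "\<And>j. j < m \<Longrightarrow> c j = 0"
    unfolding m_def using c LeastI[of "\<lambda>j. c j \<noteq> 0"] not_less_Least[of _ "\<lambda>j. c j \<noteq> 0"] by blast+
  have "m \<le> ?d" using c below by (metis atMost_iff le_trans linorder_not_le)
  define q where
    "q = (\<lambda>i k. \<Sum>j\<in>{m<..?d}. (- c j / c m) * tensor_pow N A (j - Suc m) i k)"
  have comm_pow: "tensor_pow N A j \<star>\<^bsub>N\<^esub> A = A \<star>\<^bsub>N\<^esub> tensor_pow N A j" for j
    using tensor_pow_add[OF A, of 1 j] tensor_pow_1[OF A] by simp
  have closed: "q \<in> sq_tensors N"
    using tensor_pow_closed[OF A] unfolding q_def sq_tensors_def by simp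
  have comm: "q \<star>\<^bsub>N\<^esub> A = A \<star>\<^bsub>N\<^esub> q"
    unfolding q_def eprod_sum_left eprod_sum_right comm_pow ..
  have "tensor_pow N A (Suc m) = tensor_pow N A (Suc (Suc m)) \<star>\<^bsub>N\<^esub> q"
  proof (intro ext)
    fix i k
    have pow: "(tensor_pow N A (Suc (Suc m)) \<star>\<^bsub>N\<^esub> tensor_pow N A (j - Suc m))
        = tensor_pow N A (Suc j)" if "m < j" for j
      using that by (subst tensor_pow_add[OF A, symmetric]) simp
    have "(tensor_pow N A (Suc (Suc m)) \<star>\<^bsub>N\<^esub> q) i k
        = (\<Sum>j\<in>{m<..?d}. (- c j / c m) * tensor_pow N A (Suc j) i k)"
      unfolding q_def eprod_sum_right by (rule sum.cong) (simp_all only: pow greaterThanAtMost_iff)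
    also have "\<dots> = - (\<Sum>j\<in>{m<..?d}. c j * tensor_pow N A (Suc j) i k) / c m"
      by (simp add: sum_divide_distrib sum_negf)
    also have "(\<Sum>j\<in>{m<..?d}. c j * tensor_pow N A (Suc j) i k)
        = - c m * tensor_pow N A (Suc m) i k"
    proof -
      have "0 = (\<Sum>j\<le>?d. c j * tensor_pow N A (Suc j) i k)"
        using rel tensor_pow_closed[OF A] unfolding sq_tensors_def
        by (cases "(i, k) \<in> ?I") (auto simp del: tensor_pow.simps)
      also have "\<dots> = (\<Sum>j\<in>{m..?d}. c j * tensor_pow N A (Suc j) i k)"
        by (rule sum.mono_neutral_right) (auto simp: below)
      also have "\<dots> = c m * tensor_pow N A (Suc m) i k
          + (\<Sum>j\<in>{m<..?d}. c j * tensor_pow N A (Suc j) i k)"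
        by (rule sum.head[OF \<open>m \<le> ?d\<close>])
      finally show ?thesis by (simp add: eq_neg_iff_add_eq_0 add.commute)
    qed
    finally show "tensor_pow N A (Suc m) i k = (tensor_pow N A (Suc (Suc m)) \<star>\<^bsub>N\<^esub> q) i k"
      using m by simp
  qed
  with closed comm show ?thesis by (rule that)
qed

section \<open>Existence of the core inverse\<close>

lemma tensor_range_eprod_subset:
  assumes "B \<in> sq_tensors N"
  shows "tensor_range N (A \<star>\<^bsub>N\<^esub> B) \<subseteq> tensor_range N A"
  unfolding tensor_range_def using assms eprod_vec_closed by (auto simp: eprod_vec_assoc)

text \<open>
  Since the index is a least element, this requires some exponent at which the ranges become
  stationary.
\<close>

lemma core_tensor_range:
  assumes "core_tensor N A"
  shows "tensor_range N A = tensor_range N (A \<star>\<^bsub>N\<^esub> A)"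
proof -
  have A: "A \<in> sq_tensors N" and ind: "tensor_index N A = 1"
    using assms by (auto simp: core_tensor_def)
  obtain m q where q: "q \<in> sq_tensors N"
    "tensor_pow N A (Suc m) = tensor_pow N A (Suc (Suc m)) \<star>\<^bsub>N\<^esub> q"
    by (rule tensor_pow_strongly_regular[OF A])
  let ?P = "\<lambda>k. 0 < k \<and>
    tensor_range N (tensor_pow N A k) = tensor_range N (tensor_pow N A (k + 1))"
  have "tensor_range N (tensor_pow N A (Suc m)) \<subseteq> tensor_range N (tensor_pow N A (Suc (Suc m)))"
    using tensor_range_eprod_subset[OF q(1)] q(2) by metis
  moreover have "tensor_range N (tensor_pow N A (Suc (Suc m))) \<subseteq> tensor_range N (tensor_pow N A (Suc m))"
    using tensor_range_eprod_subset[OF A] by (metis tensor_pow.simps(2))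
  ultimately have "?P (Suc m)" by auto
  then have "?P (tensor_index N A)"
    unfolding tensor_index_def by (rule LeastI)
  then show ?thesis
    using A unfolding ind by (simp add: eprod_unit_left)
qed

lemma factor_if_tensor_range_subset:
  assumes A: "A \<in> sq_tensors N" and sub: "tensor_range N A \<subseteq> tensor_range N B"
  obtains Z where "A = B \<star>\<^bsub>N\<^esub> Z"
proof -
  \<comment> \<open>Each column of \<open>A\<close> lies in the range of \<open>B\<close>; the preimages are the columns of \<open>Z\<close>.\<close>
  have "\<exists>X. (\<lambda>i. A i j) = eprod_vec N B X" for j
  proof (cases "j \<in> multi_indices N")
    case True
    let ?e = "\<lambda>k. if k = j then 1 else 0 :: complex"
    have "(\<lambda>i. A i j) = eprod_vec N A ?e"
      using True by (simp add: eprod_vec_def finite_multi_indices if_distrib cong: if_cong)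
    moreover have "?e \<in> vec_tensors N" using True by (auto simp: vec_tensors_def)
    ultimately have "(\<lambda>i. A i j) \<in> tensor_range N A" unfolding tensor_range_def by blast
    then show ?thesis using sub unfolding tensor_range_def by blast
  next
    case False
    then have "(\<lambda>i. A i j) = eprod_vec N B (\<lambda>_. 0)"
      using A by (simp add: sq_tensors_def eprod_vec_def)
    then show ?thesis by blast
  qed
  then obtain X where X: "\<And>j. (\<lambda>i. A i j) = eprod_vec N B (X j)" by metis
  have "A = B \<star>\<^bsub>N\<^esub> (\<lambda>i j. X j i)"
    using X by (auto simp: fun_eq_iff eprod_def eprod_vec_def)
  then show ?thesis by (rule that)
qed

text \<open>
  From \<open>A = A A Z\<close> follows \<open>A = A ^ (m + 1) W\<close>, so the relation between the powers of \<open>A\<close>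
  cancels down to exponent 1.
\<close>

lemma core_tensor_commuting_inverse:
  assumes "core_tensor N A"
  obtains g where "g \<in> sq_tensors N" "g \<star>\<^bsub>N\<^esub> A = A \<star>\<^bsub>N\<^esub> g" "A \<star>\<^bsub>N\<^esub> A \<star>\<^bsub>N\<^esub> g = A"
proof -
  have A: "A \<in> sq_tensors N" using assms by (simp add: core_tensor_def)
  obtain m q where q: "q \<in> sq_tensors N" "q \<star>\<^bsub>N\<^esub> A = A \<star>\<^bsub>N\<^esub> q"
    and pow: "tensor_pow N A (Suc m) = tensor_pow N A (Suc (Suc m)) \<star>\<^bsub>N\<^esub> q"
    by (rule tensor_pow_strongly_regular[OF A])
  obtain Z where Z: "A = A \<star>\<^bsub>N\<^esub> A \<star>\<^bsub>N\<^esub> Z"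
    using factor_if_tensor_range_subset[OF A] core_tensor_range[OF assms] by blast
  have "\<exists>W. A = tensor_pow N A (Suc k) \<star>\<^bsub>N\<^esub> W" for k
  proof (induction k)
    case 0
    show ?case using eprod_unit_right[OF A] tensor_pow_1[OF A] by metis
  next
    case (Suc k)
    then obtain W where W: "A = tensor_pow N A (Suc k) \<star>\<^bsub>N\<^esub> W" ..
    have "tensor_pow N A (Suc k) = tensor_pow N A (Suc (Suc k)) \<star>\<^bsub>N\<^esub> Z"
      using Z by (metis eprod_assoc tensor_pow.simps(2))
    with W show ?case by (metis eprod_assoc)
  qed
  then obtain W where W: "A = tensor_pow N A (Suc m) \<star>\<^bsub>N\<^esub> W" by blast
  have comm_pow: "q \<star>\<^bsub>N\<^esub> tensor_pow N A k = tensor_pow N A k \<star>\<^bsub>N\<^esub> q" for k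
  proof (induction k)
    case 0
    show ?case using q(1) by (simp add: eprod_unit_left eprod_unit_right)
  next
    case (Suc k)
    then show ?case using q(2) by (metis eprod_assoc tensor_pow.simps(2))
  qed
  have shift: "tensor_pow N A (Suc (Suc m)) = A \<star>\<^bsub>N\<^esub> tensor_pow N A (Suc m)"
    using tensor_pow_add[OF A, of "Suc 0" "Suc m"] tensor_pow_1[OF A] by simp
  have "tensor_pow N A (Suc m) = q \<star>\<^bsub>N\<^esub> (A \<star>\<^bsub>N\<^esub> tensor_pow N A (Suc m))"
    using pow comm_pow shift by metis
  then have "A = q \<star>\<^bsub>N\<^esub> (A \<star>\<^bsub>N\<^esub> A)"
    using W by (metis eprod_assoc)
  then have "A \<star>\<^bsub>N\<^esub> A \<star>\<^bsub>N\<^esub> q = A"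
    using q(2) by (metis eprod_assoc)
  with q show ?thesis by (rule that)
qed

text \<open>Positive definiteness: \<open>A\<^sup>* A u = 0\<close> forces \<open>\<parallel>A u\<parallel>\<^sup>2 = \<langle>u, A\<^sup>* A u\<rangle> = 0\<close>, columnwise.\<close>

lemma conj_transpose_cancel:
  assumes A: "A \<in> sq_tensors N"
    and eq: "conj_transpose A \<star>\<^bsub>N\<^esub> (A \<star>\<^bsub>N\<^esub> Y) = conj_transpose A \<star>\<^bsub>N\<^esub> (A \<star>\<^bsub>N\<^esub> Z)"
  shows "A \<star>\<^bsub>N\<^esub> Y = A \<star>\<^bsub>N\<^esub> Z"
proof (intro ext)
  fix i j
  let ?I = "multi_indices N"
  define u where "u = (\<lambda>k. Y k j - Z k j)"
  define w where "w = (\<lambda>k. (A \<star>\<^bsub>N\<^esub> Y) k j - (A \<star>\<^bsub>N\<^esub> Z) k j)"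
  have w: "w k = (\<Sum>l\<in>?I. A k l * u l)" for k
    by (simp add: w_def u_def eprod_def right_diff_distrib sum_subtractf)
  have zero: "(\<Sum>k\<in>?I. cnj (A k l) * w k) = 0" for l
    using fun_cong[OF fun_cong[OF eq], of l j]
    by (simp add: w_def right_diff_distrib sum_subtractf conj_transpose_def
        eprod_def[of N "\<lambda>i j. cnj (A j i)"])
  have "(\<Sum>k\<in>?I. cnj (w k) * w k) = (\<Sum>k\<in>?I. \<Sum>l\<in>?I. cnj (u l) * (cnj (A k l) * w k))"
    by (subst w) (simp add: sum_distrib_right sum_distrib_left mult_ac)
  also have "\<dots> = (\<Sum>l\<in>?I. cnj (u l) * (\<Sum>k\<in>?I. cnj (A k l) * w k))"
    by (subst sum.swap) (simp add: sum_distrib_left)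
  also have "\<dots> = 0" by (simp add: zero)
  finally have "complex_of_real (\<Sum>k\<in>?I. (cmod (w k))\<^sup>2) = 0"
    unfolding of_real_sum of_real_power by (simp add: complex_norm_square[symmetric] mult.commute)
  then have "(\<Sum>k\<in>?I. (cmod (w k))\<^sup>2) = 0" by (simp only: of_real_eq_0_iff)
  then have "\<forall>k\<in>?I. w k = 0"
    by (simp add: sum_nonneg_eq_0_iff finite_multi_indices)
  moreover have "w i = 0" if "i \<notin> ?I"
    using that A by (simp add: w sq_tensors_def)
  ultimately show "(A \<star>\<^bsub>N\<^esub> Y) i j = (A \<star>\<^bsub>N\<^esub> Z) i j"
    unfolding w_def by fastforce
qed

text \<open>
  Every tensor has an inner inverse \<open>w\<close> for which \<open>A w\<close> is Hermitian. With \<open>H = A\<^sup>* A\<close>, cancellation turns the relation between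
  the powers of \<open>H\<close> into \<open>A = A H q\<close>, and the inverse is \<open>q A\<^sup>*\<close>.
\<close>

lemma hermitian_inner_inverse:
  assumes A: "A \<in> sq_tensors N"
  obtains w where "w \<in> sq_tensors N" "A \<star>\<^bsub>N\<^esub> w \<star>\<^bsub>N\<^esub> A = A"
    "conj_transpose (A \<star>\<^bsub>N\<^esub> w) = A \<star>\<^bsub>N\<^esub> w"
proof -
  let ?S = "conj_transpose A"
  define H where "H = ?S \<star>\<^bsub>N\<^esub> A"
  have S: "?S \<in> sq_tensors N" and H: "H \<in> sq_tensors N"
    using A by (simp_all add: H_def eprod_closed conj_transpose_closed)
  have Hstar: "conj_transpose H = H"
    by (simp add: H_def tensor.star_mult tensor.star_star)
  obtain m q where q: "q \<in> sq_tensors N" and comm: "q \<star>\<^bsub>N\<^esub> H = H \<star>\<^bsub>N\<^esub> q"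
    and pow: "tensor_pow N H (Suc m) = tensor_pow N H (Suc (Suc m)) \<star>\<^bsub>N\<^esub> q"
    by (rule tensor_pow_strongly_regular[OF H])
  have shift: "tensor_pow N H (Suc k) = H \<star>\<^bsub>N\<^esub> tensor_pow N H k" for k
    using tensor_pow_add[OF H, of "Suc 0" k] tensor_pow_1[OF H] by simp
  have cancel: "tensor_pow N H (Suc k) \<star>\<^bsub>N\<^esub> Y = tensor_pow N H (Suc k) \<star>\<^bsub>N\<^esub> Z
      \<Longrightarrow> H \<star>\<^bsub>N\<^esub> Y = H \<star>\<^bsub>N\<^esub> Z" for k Y Z
  proof (induction k)
    case 0
    then show ?case by (simp only: tensor_pow_1[OF H])
  next
    case (Suc k)
    have "conj_transpose H \<star>\<^bsub>N\<^esub> (H \<star>\<^bsub>N\<^esub> (tensor_pow N H k \<star>\<^bsub>N\<^esub> Y))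
        = conj_transpose H \<star>\<^bsub>N\<^esub> (H \<star>\<^bsub>N\<^esub> (tensor_pow N H k \<star>\<^bsub>N\<^esub> Z))"
      using Suc.prems unfolding Hstar shift by (simp only: eprod_assoc)
    then have "H \<star>\<^bsub>N\<^esub> (tensor_pow N H k \<star>\<^bsub>N\<^esub> Y) = H \<star>\<^bsub>N\<^esub> (tensor_pow N H k \<star>\<^bsub>N\<^esub> Z)"
      by (rule conj_transpose_cancel[OF H])
    then show ?case by (intro Suc.IH) (simp only: shift eprod_assoc)
  qed
  have "tensor_pow N H (Suc m) \<star>\<^bsub>N\<^esub> unit_tensor N = tensor_pow N H (Suc m) \<star>\<^bsub>N\<^esub> (H \<star>\<^bsub>N\<^esub> q)"
    using pow eprod_unit_right[OF tensor_pow_closed[OF H]] by (metis eprod_assoc tensor_pow.simps(2))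
  then have "H \<star>\<^bsub>N\<^esub> unit_tensor N = H \<star>\<^bsub>N\<^esub> (H \<star>\<^bsub>N\<^esub> q)"
    by (rule cancel)
  then have "?S \<star>\<^bsub>N\<^esub> (A \<star>\<^bsub>N\<^esub> unit_tensor N) = ?S \<star>\<^bsub>N\<^esub> (A \<star>\<^bsub>N\<^esub> (H \<star>\<^bsub>N\<^esub> q))"
    unfolding H_def by (simp only: eprod_assoc)
  then have "A \<star>\<^bsub>N\<^esub> unit_tensor N = A \<star>\<^bsub>N\<^esub> (H \<star>\<^bsub>N\<^esub> q)"
    by (rule conj_transpose_cancel[OF A])
  then have AHq: "A \<star>\<^bsub>N\<^esub> (H \<star>\<^bsub>N\<^esub> q) = A"
    by (simp add: eprod_unit_right[OF A])
  let ?Q = "conj_transpose q"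
  have commQ: "?Q \<star>\<^bsub>N\<^esub> H = H \<star>\<^bsub>N\<^esub> ?Q"
    using comm Hstar tensor.star_mult by metis
  have QHS: "?Q \<star>\<^bsub>N\<^esub> H \<star>\<^bsub>N\<^esub> ?S = ?S"
    using AHq Hstar tensor.star_mult by metis
  have "A \<star>\<^bsub>N\<^esub> (q \<star>\<^bsub>N\<^esub> ?S) = A \<star>\<^bsub>N\<^esub> q \<star>\<^bsub>N\<^esub> (H \<star>\<^bsub>N\<^esub> ?Q) \<star>\<^bsub>N\<^esub> ?S"
    using QHS commQ by (metis eprod_assoc)
  also have "\<dots> = A \<star>\<^bsub>N\<^esub> (H \<star>\<^bsub>N\<^esub> q) \<star>\<^bsub>N\<^esub> ?Q \<star>\<^bsub>N\<^esub> ?S"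
    using comm by (metis eprod_assoc)
  also have "\<dots> = conj_transpose (A \<star>\<^bsub>N\<^esub> (q \<star>\<^bsub>N\<^esub> ?S))"
    unfolding AHq by (simp add: tensor.star_mult tensor.star_star)
  finally have "conj_transpose (A \<star>\<^bsub>N\<^esub> (q \<star>\<^bsub>N\<^esub> ?S)) = A \<star>\<^bsub>N\<^esub> (q \<star>\<^bsub>N\<^esub> ?S)" ..
  moreover have "A \<star>\<^bsub>N\<^esub> (q \<star>\<^bsub>N\<^esub> ?S) \<star>\<^bsub>N\<^esub> A = A"
    using AHq comm unfolding H_def by (metis eprod_assoc)
  ultimately show ?thesis
    using that eprod_closed[OF q S] by blast
qed

section \<open>The reverse order laws for tensors\<close>

lemma is_core_inverse_iff:
  assumes "A \<in> sq_tensors N"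
  shows "is_core_inverse N A X \<longleftrightarrow> X \<in> sq_tensors N \<and> tensor.core_inv N A X"
  using assms by (auto simp: is_core_inverse_def tensor.core_inv_def tensor_pow_2)

lemma is_group_inverse_iff:
  assumes "A \<in> sq_tensors N"
  shows "is_group_inverse N A X \<longleftrightarrow> X \<in> sq_tensors N \<and> tensor.group_inv N A X"
  using assms by (auto simp: is_group_inverse_def tensor.group_inv_def tensor_pow_2)

lemma is_core_inverse_core_inverse:
  assumes "core_tensor N A"
  shows "is_core_inverse N A (core_inverse N A)"
proof -
  have A: "A \<in> sq_tensors N" using assms by (simp add: core_tensor_def)
  obtain g where g: "g \<in> sq_tensors N" "g \<star>\<^bsub>N\<^esub> A = A \<star>\<^bsub>N\<^esub> g" "A \<star>\<^bsub>N\<^esub> A \<star>\<^bsub>N\<^esub> g = A"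
    by (rule core_tensor_commuting_inverse[OF assms])
  obtain w where w: "w \<in> sq_tensors N" "A \<star>\<^bsub>N\<^esub> w \<star>\<^bsub>N\<^esub> A = A"
    "conj_transpose (A \<star>\<^bsub>N\<^esub> w) = A \<star>\<^bsub>N\<^esub> w"
    by (rule hermitian_inner_inverse[OF A])
  have core: "is_core_inverse N A (g \<star>\<^bsub>N\<^esub> A \<star>\<^bsub>N\<^esub> w)"
    unfolding is_core_inverse_iff[OF A]
    using tensor.core_inv_exists[OF g(3,2) w(2,3)] A g w by (simp add: eprod_closed)
  moreover have "X = g \<star>\<^bsub>N\<^esub> A \<star>\<^bsub>N\<^esub> w" if "is_core_inverse N A X" for X
    using that core tensor.core_inv_unique unfolding is_core_inverse_iff[OF A] by blast
  ultimately show ?thesis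
    unfolding core_inverse_def by (rule theI)
qed

lemma group_inverse_eq_iff:
  assumes "A \<in> sq_tensors N" and "X \<in> sq_tensors N"
  shows "group_invertible N A \<and> group_inverse N A = X \<longleftrightarrow> tensor.group_inv N A X"
proof -
  have "\<exists>!X. is_group_inverse N A X" if "is_group_inverse N A X" for X
    using that tensor.group_inv_unique assms by (auto simp: is_group_inverse_iff)
  then have "group_invertible N A \<and> group_inverse N A = X \<longleftrightarrow> is_group_inverse N A X"
    unfolding group_invertible_def group_inverse_def by (metis the1_equality)
  then show ?thesis using assms by (simp add: is_group_inverse_iff)
qed

theorem theorem4p4:
  fixes N :: "nat list" and A B :: sq_tensor
  assumes "N \<noteq> []" and "\<forall>d\<in>set N. 1 \<le> d"
    and "core_tensor N A" and "core_tensor N B"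
  shows
    "(group_invertible N (A \<star>\<^bsub>N\<^esub> B) \<and>
      group_inverse N (A \<star>\<^bsub>N\<^esub> B) = core_inverse N B \<star>\<^bsub>N\<^esub> core_inverse N A \<and>
      group_invertible N (B \<star>\<^bsub>N\<^esub> A) \<and>
      group_inverse N (B \<star>\<^bsub>N\<^esub> A) = core_inverse N A \<star>\<^bsub>N\<^esub> core_inverse N B)
     \<longleftrightarrow>
     (core_inverse N A \<star>\<^bsub>N\<^esub> A \<star>\<^bsub>N\<^esub> B = B \<star>\<^bsub>N\<^esub> A \<star>\<^bsub>N\<^esub> core_inverse N A \<and>
      core_inverse N B \<star>\<^bsub>N\<^esub> B \<star>\<^bsub>N\<^esub> A = A \<star>\<^bsub>N\<^esub> B \<star>\<^bsub>N\<^esub> core_inverse N B \<and>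
      A \<star>\<^bsub>N\<^esub> core_inverse N A \<star>\<^bsub>N\<^esub> core_inverse N B
        = core_inverse N B \<star>\<^bsub>N\<^esub> core_inverse N A \<star>\<^bsub>N\<^esub> A)"
proof -
  have A: "A \<in> sq_tensors N" and B: "B \<in> sq_tensors N"
    using assms by (simp_all add: core_tensor_def)
  have "core_inverse N A \<in> sq_tensors N" "tensor.core_inv N A (core_inverse N A)"
    using is_core_inverse_core_inverse[OF assms(3)] A by (simp_all add: is_core_inverse_iff)
  moreover have "core_inverse N B \<in> sq_tensors N" "tensor.core_inv N B (core_inverse N B)"
    using is_core_inverse_core_inverse[OF assms(4)] B by (simp_all add: is_core_inverse_iff)
  ultimately show ?thesis
    using tensor.group_inv_core_products_iff[of N A "core_inverse N A" B "core_inverse N B"]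
      group_inverse_eq_iff[of "A \<star>\<^bsub>N\<^esub> B" N "core_inverse N B \<star>\<^bsub>N\<^esub> core_inverse N A"]
      group_inverse_eq_iff[of "B \<star>\<^bsub>N\<^esub> A" N "core_inverse N A \<star>\<^bsub>N\<^esub> core_inverse N B"]
      A B by (simp add: eprod_closed) blast
qed

end
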